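(* Suppose that $\xi_c=\infty$ and that $\psi_s(p)$ denotes the whole feasible region of the SCED problem (rather than its set of optimal solutions). Then Algorithm AODC (alternating optimization with double constraints, described in the context) terminates after finitely many iterations and returns an optimal solution of the PPOP problem $\min\{\|\beta\|_0:\ \beta\in\{0,1\}^{|V|},\ \psi_a(\beta)=0\}$.
   Context: Grid. $(V,E)$ is a connected undirected graph (buses, lines). Each line $e$ has a reactance $r_e>0$ and an arbitrary orientation. $\tilde D\in\{-1,0,1\}^{|V|\times|E|}$ is the incidence matrix ($1$ if the line comes out of the node, $-1$ if it goes into the node, $0$ otherwise), with rows $\tilde D_u$ and columns $\tilde d_e$. $\Gamma=\mathrm{diag}(1/r_e)$, with diagonal entries $\Gamma_e$, and $\tilde B=\tilde D\Gamma\tilde D^T$. $V_g,V_d\subseteq V$ are the generator and load buses, and $\Lambda_g,\Lambda_d$ are the 0/1 matrices selecting the corresponding coordinates of a vector in $\mathbb R^{|V|}$. $u_0\in V$ is a reference node. Further data: pre-attack injections $p_0\in\mathbb R^{|V|}$, line limits $f_{\max}\in\mathbb R^{|E|}$, tripping thresholds $\gamma_e$ ($e\in E$), generation bounds $p_{g,\min},p_{g,\max}$, load fluctuation $\alpha\ge 0$, physical attack budget $\xi_p$. The cyber budget $\xi_c$ bounds the number of manipulated measurements; $\xi_c=\infty$ means no such constraint. $\|\cdot\|_0$ is the number of nonzero entries; vector inequalities and $|\cdot|$ of vectors are entrywise. SCED feasible region. For $p\in\mathbb R^{|V|}$, $\psi_s(p)$ is the set of $\theta\in\mathbb R^{|V|}$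 with $\Lambda_d\tilde B\theta=\Lambda_d p$, $-f_{\max}\le\Gamma\tilde D^T\theta\le f_{\max}$, $p_{g,\min}\le\Lambda_g\tilde B\theta\le p_{g,\max}$. PMUs. For $\beta\in\{0,1\}^{|V|}$: $x_N(\beta)_u=1$ iff $\beta_v=1$ for some $v$ equal or adjacent to $u$, else $0$; $x_L(\beta)_e=1$ iff some endpoint $v$ of $e$ has $\beta_v=1$, else $0$. Write $x_N,x_L$. Attacker's problem. $\psi_a(\beta)$ is the maximum of $|\{e\in E:\ |f_{3,e}|>\gamma_e f_{\max,e}\}|$ over $a_p\in\{0,1\}^{|E|}$, $\theta_2,\theta_3,\tilde\theta_2,\tilde\theta_3\in\mathbb R^{|V|}$, $f_2,f_3,\tilde f_2,f_{con}\in\mathbb R^{|E|}$ subject to: (1) $\tilde D_{u_0}f_{con}=|V|-1$, $\tilde D_u f_{con}=-1$ for $u\ne u_0$, $|f_{con,e}|\le|V|(1-a_{p,e})$ for all $e$; (2) $x_{L,e}=1\Rightarrow a_{p,e}=0$; $x_{N,u}=1\Rightarrow\tilde\theta_{2,u}=\theta_{2,u}$; $\|a_p\|_0\le\xi_p$; (3) $\tilde Df_2=p_0$, and for each $e$: $f_{2,e}=0$ if $a_{p,e}=1$, $f_{2,e}=\Gamma_e\tilde d_e^T\theta_2$ if $a_{p,e}=0$; (4) $\tilde f_2=\Gamma\tilde D^T\tilde\theta_2$, $-f_{\max}\le\tilde f_2\le f_{\max}$, $-\alpha|p_0|\le\tilde D\tilde f_2-p_0\le\alpha|p_0|$, $\Lambda_g\tilde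 D\tilde f_2=\Lambda_g p_0$; (5) $\tilde\theta_3\in\psi_s(\tilde B\tilde\theta_2)$; (6) $\Lambda_d\tilde Df_3=\Lambda_d p_0$, $\Lambda_g\tilde Df_3=\Lambda_g\tilde B\tilde\theta_3$, and for each $e$: $f_{3,e}=0$ if $a_{p,e}=1$, $f_{3,e}=\Gamma_e\tilde d_e^T\theta_3$ if $a_{p,e}=0$; (7) $\theta_{2,u_0}=\theta_{3,u_0}=\tilde\theta_{2,u_0}=\tilde\theta_{3,u_0}=0$. A pair $(a_p,e)$ is a successful attack pair under $\beta$ if some feasible point with this $a_p$ has $|f_{3,e}|>\gamma_ef_{\max,e}$. Linear system of an attack pair. Fix $(a_p,e)$, with $e$ oriented in the direction of the overload. Put $D=\tilde D-\tilde D\,\mathrm{diag}(a_p)$ with columns $d_e$, $B=\tilde B-\tilde D\Gamma\,\mathrm{diag}(a_p)\tilde D^T$, and let $\theta_2$ be the (constant) post-attack phase angle vector determined by (3) and (7). Let $M_{2,\theta}>0$ be a constant large enough that $|\tilde\theta_{2,u}-\theta_{2,u}|\le M_{2,\theta}$ for all feasible points and all $u$. With $y=(\tilde\theta_2,\tilde\theta_3,\theta_3)$, consider the system $$F_1y=s_1,\qquad F_2y\le s_2+F_3x_N,\qquad (\ast)$$ where $F_1y=s_1$ consists of $\Lambda_g\tilde B\tilde\theta_2=\Lambda_gp_0$, $\Lambda_dB\theta_3=\Lambda_dp_0$, $\Lambda_gB\theta_3=\Lambda_g\tilde B\tilde\theta_3$, $\Lambda_d\tilde B\tilde\theta_2=\Lambda_d\tilde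 B\tilde\theta_3$, $\tilde\theta_{2,u_0}=\tilde\theta_{3,u_0}=\theta_{3,u_0}=0$; and $F_2y\le s_2+F_3x_N$ consists of $\pm(\tilde B\tilde\theta_2-p_0)\le\alpha|p_0|$, $\pm(\tilde\theta_2-\theta_2)\le M_{2,\theta}(\mathbf 1-x_N)$, $-\Gamma_ed_e^T\theta_3\le-\gamma_ef_{\max,e}$, $\pm\Gamma\tilde D^T\tilde\theta_3\le f_{\max}$, $p_{g,\min}\le\Lambda_g\tilde B\tilde\theta_3\le p_{g,\max}$, $\pm\Gamma\tilde D^T\tilde\theta_2\le f_{\max}$ (the terms in $x_N$ being collected in $F_3x_N$). Convention: the boundary case of equality in the overload inequality is disregarded, so that when the physical attack $a_p$ is not blocked by PMUs, the pair $(a_p,e)$ is regarded as successful if and only if $(\ast)$ is feasible. Superscripts $(k)$ below refer to the pair $(a_p^{(k)},e^{(k)})$; $F_3$ does not depend on $k$. Algorithm AODC. Start with $k=1$, $\hat\beta^{(1)}=0$. At iteration $K$, solve the attacker's problem under $\hat\beta^{(K)}$. If $\psi_a(\hat\beta^{(K)})=0$, stop and return $\hat\beta^{(K)}$. Otherwise take a successful attack pair $(a_p^{(K)},e^{(K)})$ under $\hat\beta^{(K)}$, and compute $\hat\beta'^{(K)}\in\{0,1\}^{|V|}$ maximizing $\|\hat\beta'\|_0$ subject to $\psi_a(\hat\beta')\ge1$ and $\hat\beta'_u=1$ for all $u$ with $\hat\beta^{(K)}_u=1$. Then $\hat\beta^{(K+1)}$ is the $\beta$-part of an optimal solution of: minimize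 $\|\beta\|_0$ over $\beta\in\{0,1\}^{|V|}$, $x_N=x_N(\beta)$, $x_L=x_L(\beta)$ and, for $k=1,\dots,K$, real vectors $q_1^{(k)}$, $q_2^{(k)}\ge0$ and $w_{a,k}\in\{0,1\}$, subject for every $k=1,\dots,K$ to the No-Good constraint $\sum_{i:\hat\beta'^{(k)}_i=0}\beta_i\ge1$ and the Attack-Denial constraints $$(F_1^{(k)})^Tq_1^{(k)}+(F_2^{(k)})^Tq_2^{(k)}=0,\quad (s_1^{(k)})^Tq_1^{(k)}+(s_2^{(k)}+F_3x_N)^Tq_2^{(k)}\le w_{a,k}-1,\quad \sum_{l:a^{(k)}_{p,l}=1}x_{L,l}\ge w_{a,k}.$$
   Formalization: That the algorithm never gets stuck before returning a placement is proved under the added assumption that some placement with ψ_a(β)=0 exists; otherwise PPOP has no optimal solution to return. A single bus without lines is not covered. *)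

theory Defs
  imports "HOL-Analysis.Analysis"
begin

section \<open>Vectors and matrices\<close>

definition norm0 :: "real^'n \<Rightarrow> nat" where
  "norm0 x = card {i. x $ i \<noteq> 0}"

definition binary :: "real^'n \<Rightarrow> bool" where
  "binary x \<longleftrightarrow> (\<forall>i. x $ i \<in> {0, 1})"

definition diagmat :: "real^'n \<Rightarrow> real^'n^'n" where
  "diagmat x = (\<chi> i j. if i = j then x $ i else 0)"

section \<open>The grid\<close>

text \<open>Buses are the elements of the finite type \<open>'v\<close>, lines those of the finite type \<open>'e\<close>; a line
  \<open>e\<close> is oriented from \<open>src e\<close> to \<open>dst e\<close>, and parallel lines are allowed. Only the entries of
  \<open>pg_min\<close> and \<open>pg_max\<close> at generator buses are ever used.\<close>

record ('v::finite, 'e::finite) grid =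
  src :: "'e \<Rightarrow> 'v"
  dst :: "'e \<Rightarrow> 'v"
  reactance :: "'e \<Rightarrow> real"
  gen_buses :: "'v set"
  load_buses :: "'v set"
  ref_bus :: 'v
  p0 :: "real^'v"
  f_max :: "real^'e"
  trip :: "'e \<Rightarrow> real"
  pg_min :: "real^'v"
  pg_max :: "real^'v"
  fluct :: real
  phys_budget :: nat

definition adjacent :: "('v::finite, 'e::finite) grid \<Rightarrow> 'v \<Rightarrow> 'v \<Rightarrow> bool" where
  "adjacent G u v \<longleftrightarrow> (\<exists>e. {src G e, dst G e} = {u, v})"

definition valid_grid :: "('v::finite, 'e::finite) grid \<Rightarrow> bool" where
  "valid_grid G \<longleftrightarrow>
     (\<forall>e. src G e \<noteq> dst G e) \<and>
     (\<forall>u v. (adjacent G)\<^sup>*\<^sup>* u v) \<and>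
     (\<forall>e. reactance G e > 0) \<and>
     fluct G \<ge> 0"

definition incidence :: "('v::finite, 'e::finite) grid \<Rightarrow> real^'e^'v" where
  "incidence G = (\<chi> u e. if u = src G e then 1 else if u = dst G e then -1 else 0)"

definition suscept :: "('v::finite, 'e::finite) grid \<Rightarrow> real^'e" where
  "suscept G = (\<chi> e. 1 / reactance G e)"

definition Gamma :: "('v::finite, 'e::finite) grid \<Rightarrow> real^'e^'e" where
  "Gamma G = diagmat (suscept G)"

definition Bmat :: "('v::finite, 'e::finite) grid \<Rightarrow> real^'v^'v" where
  "Bmat G = incidence G ** Gamma G ** transpose (incidence G)"

text \<open>\<open>D\<close> and \<open>B\<close> after the lines with \<open>a $ e = 1\<close> have been disconnected.\<close>

definition incidence_att :: "('v::finite, 'e::finite) grid \<Rightarrow> real^'e \<Rightarrow> real^'e^'v" where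
  "incidence_att G a = incidence G - incidence G ** diagmat a"

definition Bmat_att :: "('v::finite, 'e::finite) grid \<Rightarrow> real^'e \<Rightarrow> real^'v^'v" where
  "Bmat_att G a =
     Bmat G - incidence G ** Gamma G ** diagmat a ** transpose (incidence G)"

definition sced_region :: "('v::finite, 'e::finite) grid \<Rightarrow> real^'v \<Rightarrow> (real^'v) set" where
  "sced_region G p = {\<theta>.
     (\<forall>u\<in>load_buses G. (Bmat G *v \<theta>) $ u = p $ u) \<and>
     - f_max G \<le> (Gamma G ** transpose (incidence G)) *v \<theta> \<and>
     (Gamma G ** transpose (incidence G)) *v \<theta> \<le> f_max G \<and>
     (\<forall>u\<in>gen_buses G. pg_min G $ u \<le> (Bmat G *v \<theta>) $ u \<and> (Bmat G *v \<theta>) $ u \<le> pg_max G $ u)}"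

section \<open>PMU placements\<close>

definition xN :: "('v::finite, 'e::finite) grid \<Rightarrow> real^'v \<Rightarrow> real^'v" where
  "xN G \<beta> = (\<chi> u. if \<exists>v. (v = u \<or> adjacent G u v) \<and> \<beta> $ v = 1 then 1 else 0)"

definition xL :: "('v::finite, 'e::finite) grid \<Rightarrow> real^'v \<Rightarrow> real^'e" where
  "xL G \<beta> = (\<chi> e. if \<beta> $ src G e = 1 \<or> \<beta> $ dst G e = 1 then 1 else 0)"

section \<open>The attacker's problem\<close>

record ('v::finite, 'e::finite) attack_point =
  att :: "real^'e"
  th2 :: "real^'v"
  th3 :: "real^'v"
  tht2 :: "real^'v"
  tht3 :: "real^'v"
  fl2 :: "real^'e"
  fl3 :: "real^'e"
  flt2 :: "real^'e"
  fcon :: "real^'e"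

definition connectivity_flow :: "('v::finite, 'e::finite) grid \<Rightarrow> real^'e \<Rightarrow> real^'e \<Rightarrow> bool" where
  "connectivity_flow G a f \<longleftrightarrow>
     (incidence G *v f) $ ref_bus G = real CARD('v) - 1 \<and>
     (\<forall>u. u \<noteq> ref_bus G \<longrightarrow> (incidence G *v f) $ u = -1) \<and>
     (\<forall>e. \<bar>f $ e\<bar> \<le> real CARD('v) * (1 - a $ e))"

definition flow_law ::
  "('v::finite, 'e::finite) grid \<Rightarrow> real^'e \<Rightarrow> real^'v \<Rightarrow> real^'e \<Rightarrow> bool" where
  "flow_law G a \<theta> f \<longleftrightarrow>
     (\<forall>e. (a $ e = 1 \<longrightarrow> f $ e = 0) \<and>
          (a $ e = 0 \<longrightarrow> f $ e = suscept G $ e * (column e (incidence G) \<bullet> \<theta>)))"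

definition not_blocked :: "('v::finite, 'e::finite) grid \<Rightarrow> real^'v \<Rightarrow> real^'e \<Rightarrow> bool" where
  "not_blocked G \<beta> a \<longleftrightarrow> (\<forall>e. xL G \<beta> $ e = 1 \<longrightarrow> a $ e = 0)"

text \<open>The cyber budget is infinite, so the number of manipulated measurements is unconstrained.\<close>

definition attack_feasible ::
  "('v::finite, 'e::finite) grid \<Rightarrow> real^'v \<Rightarrow> ('v, 'e) attack_point \<Rightarrow> bool" where
  "attack_feasible G \<beta> z \<longleftrightarrow>
     binary (att z) \<and>
     connectivity_flow G (att z) (fcon z) \<and>
     not_blocked G \<beta> (att z) \<and>
     (\<forall>u. xN G \<beta> $ u = 1 \<longrightarrow> tht2 z $ u = th2 z $ u) \<and>
     norm0 (att z) \<le> phys_budget G \<and>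
     incidence G *v fl2 z = p0 G \<and>
     flow_law G (att z) (th2 z) (fl2 z) \<and>
     flt2 z = (Gamma G ** transpose (incidence G)) *v tht2 z \<and>
     - f_max G \<le> flt2 z \<and> flt2 z \<le> f_max G \<and>
     (- (fluct G *\<^sub>R \<bar>p0 G\<bar>)) \<le> incidence G *v flt2 z - p0 G \<and>
     incidence G *v flt2 z - p0 G \<le> fluct G *\<^sub>R \<bar>p0 G\<bar> \<and>
     (\<forall>u\<in>gen_buses G. (incidence G *v flt2 z) $ u = p0 G $ u) \<and>
     tht3 z \<in> sced_region G (Bmat G *v tht2 z) \<and>
     (\<forall>u\<in>load_buses G. (incidence G *v fl3 z) $ u = p0 G $ u) \<and>
     (\<forall>u\<in>gen_buses G. (incidence G *v fl3 z) $ u = (Bmat G *v tht3 z) $ u) \<and>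
     flow_law G (att z) (th3 z) (fl3 z) \<and>
     th2 z $ ref_bus G = 0 \<and> th3 z $ ref_bus G = 0 \<and>
     tht2 z $ ref_bus G = 0 \<and> tht3 z $ ref_bus G = 0"

text \<open>On \<open>nat\<close>, \<open>Sup\<close> of a bounded nonempty set is its maximum and \<open>Sup {} = 0\<close>: if the attacker
  has no feasible point, no line is overloaded.\<close>

definition psi_a :: "('v::finite, 'e::finite) grid \<Rightarrow> real^'v \<Rightarrow> nat" where
  "psi_a G \<beta> =
     (SUP z \<in> {z. attack_feasible G \<beta> z}. card {e. \<bar>fl3 z $ e\<bar> > trip G e * f_max G $ e})"

definition successful_pair ::
  "('v::finite, 'e::finite) grid \<Rightarrow> real^'v \<Rightarrow> real^'e \<Rightarrow> 'e \<Rightarrow> bool" where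
  "successful_pair G \<beta> a e \<longleftrightarrow>
     (\<exists>z. attack_feasible G \<beta> z \<and> att z = a \<and> \<bar>fl3 z $ e\<bar> > trip G e * f_max G $ e)"

text \<open>\<open>\<sigma> = 1\<close> if the overload follows the orientation of \<open>e\<close>, and \<open>\<sigma> = -1\<close> if \<open>e\<close> has to be
  reversed.\<close>

definition overload_direction ::
  "('v::finite, 'e::finite) grid \<Rightarrow> real^'v \<Rightarrow> real^'e \<Rightarrow> 'e \<Rightarrow> real \<Rightarrow> bool" where
  "overload_direction G \<beta> a e \<sigma> \<longleftrightarrow>
     \<sigma> \<in> {1, -1} \<and>
     (\<exists>z. attack_feasible G \<beta> z \<and> att z = a \<and> \<sigma> * fl3 z $ e > trip G e * f_max G $ e)"

definition ppop_feasible :: "('v::finite, 'e::finite) grid \<Rightarrow> real^'v \<Rightarrow> bool" where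
  "ppop_feasible G \<beta> \<longleftrightarrow> binary \<beta> \<and> psi_a G \<beta> = 0"

section \<open>The linear system of an attack pair\<close>

definition post_attack_angles ::
  "('v::finite, 'e::finite) grid \<Rightarrow> real^'e \<Rightarrow> real^'v \<Rightarrow> bool" where
  "post_attack_angles G a \<theta> \<longleftrightarrow>
     \<theta> $ ref_bus G = 0 \<and> (\<exists>f. incidence G *v f = p0 G \<and> flow_law G a \<theta> f)"

text \<open>The constraints on \<open>a\<close> in the attacker's problem that do not involve the PMUs.\<close>

definition admissible_attack :: "('v::finite, 'e::finite) grid \<Rightarrow> real^'e \<Rightarrow> bool" where
  "admissible_attack G a \<longleftrightarrow>
     binary a \<and> norm0 a \<le> phys_budget G \<and>
     (\<exists>f. connectivity_flow G a f) \<and> (\<exists>\<theta>. post_attack_angles G a \<theta>)"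

text \<open>For an admissible attack the remaining grid is connected, so the angles are unique.\<close>

definition theta2 :: "('v::finite, 'e::finite) grid \<Rightarrow> real^'e \<Rightarrow> real^'v" where
  "theta2 G a = (THE \<theta>. post_attack_angles G a \<theta>)"

text \<open>Unknowns \<open>y = (\<theta>~\<^sub>2, \<theta>~\<^sub>3, \<theta>\<^sub>3)\<close>. A row of \<open>F\<^sub>1\<close> or \<open>F\<^sub>2\<close> is a vector of this type, acting
  on \<open>y\<close> by the inner product; rows are indexed by the constraint they encode.\<close>

type_synonym 'v angles = "(real^'v) \<times> (real^'v) \<times> (real^'v)"

datatype 'v eq_row =
    GenFalse2 'v  \<comment> \<open>\<open>\<Lambda>\<^sub>g B~ \<theta>~\<^sub>2 = \<Lambda>\<^sub>g p\<^sub>0\<close>\<close>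
  | LoadTrue3 'v  \<comment> \<open>\<open>\<Lambda>\<^sub>d B \<theta>\<^sub>3 = \<Lambda>\<^sub>d p\<^sub>0\<close>\<close>
  | GenTrue3 'v   \<comment> \<open>\<open>\<Lambda>\<^sub>g B \<theta>\<^sub>3 = \<Lambda>\<^sub>g B~ \<theta>~\<^sub>3\<close>\<close>
  | LoadFalse 'v  \<comment> \<open>\<open>\<Lambda>\<^sub>d B~ \<theta>~\<^sub>2 = \<Lambda>\<^sub>d B~ \<theta>~\<^sub>3\<close>\<close>
  | RefFalse2
  | RefFalse3
  | RefTrue3

definition eq_rows :: "('v::finite, 'e::finite) grid \<Rightarrow> 'v eq_row set" where
  "eq_rows G = GenFalse2 ` gen_buses G \<union> LoadTrue3 ` load_buses G \<union> GenTrue3 ` gen_buses G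
     \<union> LoadFalse ` load_buses G \<union> {RefFalse2, RefFalse3, RefTrue3}"

primrec F1 :: "('v::finite, 'e::finite) grid \<Rightarrow> real^'e \<Rightarrow> 'v eq_row \<Rightarrow> 'v angles" where
  "F1 G a (GenFalse2 u) = (Bmat G $ u, 0, 0)"
| "F1 G a (LoadTrue3 u) = (0, 0, Bmat_att G a $ u)"
| "F1 G a (GenTrue3 u) = (0, - Bmat G $ u, Bmat_att G a $ u)"
| "F1 G a (LoadFalse u) = (Bmat G $ u, - Bmat G $ u, 0)"
| "F1 G a RefFalse2 = (axis (ref_bus G) 1, 0, 0)"
| "F1 G a RefFalse3 = (0, axis (ref_bus G) 1, 0)"
| "F1 G a RefTrue3 = (0, 0, axis (ref_bus G) 1)"

primrec s1 :: "('v::finite, 'e::finite) grid \<Rightarrow> 'v eq_row \<Rightarrow> real" where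
  "s1 G (GenFalse2 u) = p0 G $ u"
| "s1 G (LoadTrue3 u) = p0 G $ u"
| "s1 G (GenTrue3 u) = 0"
| "s1 G (LoadFalse u) = 0"
| "s1 G RefFalse2 = 0"
| "s1 G RefFalse3 = 0"
| "s1 G RefTrue3 = 0"

datatype ('v, 'e) ineq_row =
    FluctUp 'v | FluctLo 'v  \<comment> \<open>\<open>\<plusminus> (B~ \<theta>~\<^sub>2 - p\<^sub>0) \<le> \<alpha> \<bar>p\<^sub>0\<bar>\<close>\<close>
  | PmuUp 'v | PmuLo 'v      \<comment> \<open>\<open>\<plusminus> (\<theta>~\<^sub>2 - \<theta>\<^sub>2) \<le> M (1 - x\<^sub>N)\<close>\<close>
  | Overload                 \<comment> \<open>\<open>- \<Gamma>\<^sub>e d\<^sub>e\<^sup>T \<theta>\<^sub>3 \<le> - \<gamma>\<^sub>e f\<^sub>m\<^sub>a\<^sub>x\<^sub>,\<^sub>e\<close>\<close>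
  | Flow3Up 'e | Flow3Lo 'e  \<comment> \<open>\<open>\<plusminus> \<Gamma> D~\<^sup>T \<theta>~\<^sub>3 \<le> f\<^sub>m\<^sub>a\<^sub>x\<close>\<close>
  | GenLo 'v | GenUp 'v      \<comment> \<open>\<open>p\<^sub>g\<^sub>,\<^sub>m\<^sub>i\<^sub>n \<le> \<Lambda>\<^sub>g B~ \<theta>~\<^sub>3 \<le> p\<^sub>g\<^sub>,\<^sub>m\<^sub>a\<^sub>x\<close>\<close>
  | Flow2Up 'e | Flow2Lo 'e  \<comment> \<open>\<open>\<plusminus> \<Gamma> D~\<^sup>T \<theta>~\<^sub>2 \<le> f\<^sub>m\<^sub>a\<^sub>x\<close>\<close>

definition ineq_rows :: "('v::finite, 'e::finite) grid \<Rightarrow> ('v, 'e) ineq_row set" where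
  "ineq_rows G = range FluctUp \<union> range FluctLo \<union> range PmuUp \<union> range PmuLo \<union> {Overload}
     \<union> range Flow3Up \<union> range Flow3Lo \<union> GenLo ` gen_buses G \<union> GenUp ` gen_buses G
     \<union> range Flow2Up \<union> range Flow2Lo"

text \<open>The orientation \<open>\<sigma>\<close> of the overloaded line only matters in the overload row.\<close>

primrec F2 ::
  "('v::finite, 'e::finite) grid \<Rightarrow> real^'e \<Rightarrow> 'e \<Rightarrow> real \<Rightarrow> ('v, 'e) ineq_row \<Rightarrow> 'v angles" where
  "F2 G a e \<sigma> (FluctUp u) = (Bmat G $ u, 0, 0)"
| "F2 G a e \<sigma> (FluctLo u) = (- Bmat G $ u, 0, 0)"
| "F2 G a e \<sigma> (PmuUp u) = (axis u 1, 0, 0)"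
| "F2 G a e \<sigma> (PmuLo u) = (- axis u 1, 0, 0)"
| "F2 G a e \<sigma> Overload = (0, 0, - (suscept G $ e) *\<^sub>R (\<sigma> *\<^sub>R column e (incidence_att G a)))"
| "F2 G a e \<sigma> (Flow3Up l) = (0, suscept G $ l *\<^sub>R column l (incidence G), 0)"
| "F2 G a e \<sigma> (Flow3Lo l) = (0, - (suscept G $ l) *\<^sub>R column l (incidence G), 0)"
| "F2 G a e \<sigma> (GenLo u) = (0, - Bmat G $ u, 0)"
| "F2 G a e \<sigma> (GenUp u) = (0, Bmat G $ u, 0)"
| "F2 G a e \<sigma> (Flow2Up l) = (suscept G $ l *\<^sub>R column l (incidence G), 0, 0)"
| "F2 G a e \<sigma> (Flow2Lo l) = (- (suscept G $ l) *\<^sub>R column l (incidence G), 0, 0)"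

primrec s2 ::
  "('v::finite, 'e::finite) grid \<Rightarrow> real \<Rightarrow> real^'e \<Rightarrow> 'e \<Rightarrow> ('v, 'e) ineq_row \<Rightarrow> real" where
  "s2 G M a e (FluctUp u) = fluct G * \<bar>p0 G $ u\<bar> + p0 G $ u"
| "s2 G M a e (FluctLo u) = fluct G * \<bar>p0 G $ u\<bar> - p0 G $ u"
| "s2 G M a e (PmuUp u) = M + theta2 G a $ u"
| "s2 G M a e (PmuLo u) = M - theta2 G a $ u"
| "s2 G M a e Overload = - (trip G e * f_max G $ e)"
| "s2 G M a e (Flow3Up l) = f_max G $ l"
| "s2 G M a e (Flow3Lo l) = f_max G $ l"
| "s2 G M a e (GenLo u) = - (pg_min G $ u)"
| "s2 G M a e (GenUp u) = pg_max G $ u"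
| "s2 G M a e (Flow2Up l) = f_max G $ l"
| "s2 G M a e (Flow2Lo l) = f_max G $ l"

primrec F3 :: "real \<Rightarrow> ('v::finite, 'e::finite) ineq_row \<Rightarrow> real^'v" where
  "F3 M (FluctUp u) = 0"
| "F3 M (FluctLo u) = 0"
| "F3 M (PmuUp u) = - M *\<^sub>R axis u 1"
| "F3 M (PmuLo u) = - M *\<^sub>R axis u 1"
| "F3 M Overload = 0"
| "F3 M (Flow3Up l) = 0"
| "F3 M (Flow3Lo l) = 0"
| "F3 M (GenLo u) = 0"
| "F3 M (GenUp u) = 0"
| "F3 M (Flow2Up l) = 0"
| "F3 M (Flow2Lo l) = 0"

definition solves_system ::
  "('v::finite, 'e::finite) grid \<Rightarrow> real \<Rightarrow> real^'v \<Rightarrow> real^'e \<Rightarrow> 'e \<Rightarrow> real \<Rightarrow> 'v angles \<Rightarrow> bool"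
where
  "solves_system G M \<beta> a e \<sigma> y \<longleftrightarrow>
     (\<forall>i\<in>eq_rows G. F1 G a i \<bullet> y = s1 G i) \<and>
     (\<forall>i\<in>ineq_rows G. F2 G a e \<sigma> i \<bullet> y \<le> s2 G M a e i + F3 M i \<bullet> xN G \<beta>)"

definition big_M :: "('v::finite, 'e::finite) grid \<Rightarrow> real \<Rightarrow> bool" where
  "big_M G M \<longleftrightarrow>
     M > 0 \<and> (\<forall>\<beta> z. binary \<beta> \<and> attack_feasible G \<beta> z \<longrightarrow> (\<forall>u. \<bar>tht2 z $ u - th2 z $ u\<bar> \<le> M))"

text \<open>The strict and the non-strict overload inequality lead to the same feasible pairs: a system
  that has a solution also has one in which the overload inequality is strict. Together with
  \<open>big_M\<close> this says that a pair whose physical attack is not blocked is successful if and only if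
  its system is solvable.\<close>

definition boundary_disregarded :: "('v::finite, 'e::finite) grid \<Rightarrow> real \<Rightarrow> bool" where
  "boundary_disregarded G M \<longleftrightarrow>
     (\<forall>\<beta> a e \<sigma>. binary \<beta> \<and> admissible_attack G a \<and> not_blocked G \<beta> a \<and> \<sigma> \<in> {1, -1} \<and>
        (\<exists>y. solves_system G M \<beta> a e \<sigma> y) \<longrightarrow>
        (\<exists>y. solves_system G M \<beta> a e \<sigma> y \<and> F2 G a e \<sigma> Overload \<bullet> y < s2 G M a e Overload))"

section \<open>The algorithm\<close>

record ('v::finite, 'e::finite) iteration =
  it_att :: "real^'e"
  it_line :: 'e
  it_dir :: real
  it_max :: "real^'v"

definition no_good :: "('v::finite, 'e::finite) iteration \<Rightarrow> real^'v \<Rightarrow> bool" where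
  "no_good c \<beta> \<longleftrightarrow> (\<Sum>i | it_max c $ i = 0. \<beta> $ i) \<ge> 1"

definition attack_denial ::
  "('v::finite, 'e::finite) grid \<Rightarrow> real \<Rightarrow> ('v, 'e) iteration \<Rightarrow> real^'v \<Rightarrow>
     ('v eq_row \<Rightarrow> real) \<Rightarrow> (('v, 'e) ineq_row \<Rightarrow> real) \<Rightarrow> real \<Rightarrow> bool" where
  "attack_denial G M c \<beta> q1 q2 w \<longleftrightarrow>
     (\<forall>i\<in>ineq_rows G. q2 i \<ge> 0) \<and> w \<in> {0, 1} \<and>
     (\<Sum>i\<in>eq_rows G. q1 i *\<^sub>R F1 G (it_att c) i)
       + (\<Sum>i\<in>ineq_rows G. q2 i *\<^sub>R F2 G (it_att c) (it_line c) (it_dir c) i) = 0 \<and>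
     (\<Sum>i\<in>eq_rows G. q1 i * s1 G i)
       + (\<Sum>i\<in>ineq_rows G. q2 i * (s2 G M (it_att c) (it_line c) i + F3 M i \<bullet> xN G \<beta>)) \<le> w - 1 \<and>
     (\<Sum>l | it_att c $ l = 1. xL G \<beta> $ l) \<ge> w"

text \<open>\<open>cs\<close> lists the data of the iterations performed so far.\<close>

definition master_feasible ::
  "('v::finite, 'e::finite) grid \<Rightarrow> real \<Rightarrow> ('v, 'e) iteration list \<Rightarrow> real^'v \<Rightarrow> bool" where
  "master_feasible G M cs \<beta> \<longleftrightarrow>
     binary \<beta> \<and>
     (\<exists>q1 q2 w. \<forall>k<length cs.
        no_good (cs ! k) \<beta> \<and> attack_denial G M (cs ! k) \<beta> (q1 k) (q2 k) (w k))"

definition extension_feasible ::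
  "('v::finite, 'e::finite) grid \<Rightarrow> real^'v \<Rightarrow> real^'v \<Rightarrow> bool" where
  "extension_feasible G \<beta> \<beta>' \<longleftrightarrow>
     binary \<beta>' \<and> psi_a G \<beta>' \<ge> 1 \<and> (\<forall>u. \<beta> $ u = 1 \<longrightarrow> \<beta>' $ u = 1)"

text \<open>The choices made in one iteration with current placement \<open>\<beta>\<close>.\<close>

definition iteration_data ::
  "('v::finite, 'e::finite) grid \<Rightarrow> real^'v \<Rightarrow> ('v, 'e) iteration \<Rightarrow> bool" where
  "iteration_data G \<beta> c \<longleftrightarrow>
     successful_pair G \<beta> (it_att c) (it_line c) \<and>
     overload_direction G \<beta> (it_att c) (it_line c) (it_dir c) \<and>
     is_arg_max norm0 (extension_feasible G \<beta>) (it_max c)"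

text \<open>\<open>aodc_reaches G M cs \<beta>\<close>: for some choice of attack pairs and of optimal solutions, the
  algorithm performs the iterations \<open>cs\<close> without stopping and then has current placement \<open>\<beta>\<close>.\<close>

inductive aodc_reaches ::
  "('v::finite, 'e::finite) grid \<Rightarrow> real \<Rightarrow> ('v, 'e) iteration list \<Rightarrow> real^'v \<Rightarrow> bool"
  for G M where
  start: "aodc_reaches G M [] 0"
| step: "aodc_reaches G M cs \<beta> \<Longrightarrow> psi_a G \<beta> \<noteq> 0 \<Longrightarrow> iteration_data G \<beta> c \<Longrightarrow>
     is_arg_min norm0 (master_feasible G M (cs @ [c])) \<beta>' \<Longrightarrow>
     aodc_reaches G M (cs @ [c]) \<beta>'"

definition aodc_returns :: "('v::finite, 'e::finite) grid \<Rightarrow> real \<Rightarrow> real^'v \<Rightarrow> bool" where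
  "aodc_returns G M \<beta> \<longleftrightarrow> (\<exists>cs. aodc_reaches G M cs \<beta> \<and> psi_a G \<beta> = 0)"

end

theory Submission
  imports Defs
begin

text \<open>Monitoring more buses only restricts the attacker, so a placement without successful attacks
  has a PMU outside every placement that admits one, which is the No-Good constraint. Such a
  placement also satisfies every Attack-Denial constraint: either it blocks the physical attack, or
  the linear system of the pair is infeasible and Farkas' lemma yields the multipliers. Hence
  every master problem is a relaxation of PPOP, and its optimal solution is optimal for PPOP once
  it admits no successful attack. The No-Good constraint of an iteration excludes the current
  placement for good, so no placement is visited twice.\<close>

section \<open>Farkas' lemma\<close>

text \<open>Each row is paired with its right-hand side. A certificate amounts to
  \<open>(0, -1)\<close> lying in the cone generated by these pairs and \<open>(0, 1)\<close>. A
  finitely generated cone is closed, so otherwise a hyperplane separates the point from it, and the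
  rescaled normal solves the system.\<close>

lemma farkas:
  fixes a :: "'i \<Rightarrow> 'x::euclidean_space" and c :: "'j \<Rightarrow> 'x"
  assumes fin: "finite I" "finite J"
    and infeasible: "\<nexists>y. (\<forall>i\<in>I. a i \<bullet> y = b i) \<and> (\<forall>j\<in>J. c j \<bullet> y \<le> d j)"
  obtains q1 q2 where "\<And>j. j \<in> J \<Longrightarrow> q2 j \<ge> 0"
    and "(\<Sum>i\<in>I. q1 i *\<^sub>R a i) + (\<Sum>j\<in>J. q2 j *\<^sub>R c j) = 0"
    and "(\<Sum>i\<in>I. q1 i * b i) + (\<Sum>j\<in>J. q2 j * d j) \<le> -1"
proof -
  \<comment> \<open>Equations enter with both signs because their multipliers are free. The
    generator \<open>(0, 1)\<close> supplies the slack \<open>t\<close> that relaxes the value -1 to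
    \<open>\<le> -1\<close>.\<close>
  define S where "S = (\<lambda>i. (a i, b i)) ` I \<union> (\<lambda>i. (- a i, - b i)) ` I
    \<union> (\<lambda>j. (c j, d j)) ` J \<union> {(0, 1)}"
  define comb where "comb q1 q2 t =
    ((\<Sum>i\<in>I. q1 i *\<^sub>R a i) + (\<Sum>j\<in>J. q2 j *\<^sub>R c j),
     (\<Sum>i\<in>I. q1 i * b i) + (\<Sum>j\<in>J. q2 j * d j) + t)"
    for q1 :: "'i \<Rightarrow> real" and q2 :: "'j \<Rightarrow> real" and t :: real
  define K where "K = {k. \<exists>q1 q2 t. (\<forall>j\<in>J. 0 \<le> q2 j) \<and> 0 \<le> t \<and> k = comb q1 q2 t}"
  have add: "comb q1 q2 t + comb q1' q2' t'
      = comb (\<lambda>i. q1 i + q1' i) (\<lambda>j. q2 j + q2' j) (t + t')" for q1 q2 t q1' q2' t'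
    by (simp add: comb_def sum.distrib algebra_simps)
  have scale: "r *\<^sub>R comb q1 q2 t = comb (\<lambda>i. r * q1 i) (\<lambda>j. r * q2 j) (r * t)" for r q1 q2 t
    by (simp add: comb_def scaleR_sum_right sum_distrib_left algebra_simps)
  have KI: "comb q1 q2 t \<in> K" if "\<forall>j\<in>J. 0 \<le> q2 j" "0 \<le> t" for q1 q2 t
    using that unfolding K_def by blast
  have "comb (\<lambda>_. 0) (\<lambda>_. 0) 0 = 0"
    by (simp add: comb_def zero_prod_def)
  then have "0 \<in> K"
    using KI[of "\<lambda>_. 0" 0 "\<lambda>_. 0"] by simp
  moreover have "x + y \<in> K" if x: "x \<in> K" and y: "y \<in> K" for x y
  proof -
    obtain q1 q2 t where q: "\<forall>j\<in>J. 0 \<le> q2 j" "0 \<le> t" "x = comb q1 q2 t"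
      using x unfolding K_def by blast
    obtain q1' q2' t' where q': "\<forall>j\<in>J. 0 \<le> q2' j" "0 \<le> t'" "y = comb q1' q2' t'"
      using y unfolding K_def by blast
    show ?thesis
      unfolding q(3) q'(3) add using q(1,2) q'(1,2) by (intro KI) auto
  qed
  moreover have "r *\<^sub>R x \<in> K" if x: "x \<in> K" and r: "0 \<le> r" for x r
  proof -
    obtain q1 q2 t where q: "\<forall>j\<in>J. 0 \<le> q2 j" "0 \<le> t" "x = comb q1 q2 t"
      using x unfolding K_def by blast
    show ?thesis
      unfolding q(3) scale using q(1,2) r by (intro KI) auto
  qed
  ultimately have K: "convex_cone K"
    by (simp add: convex_cone_iff)
  \<comment> \<open>Multipliers supported on a single index pick out the single generators, which
    puts \<open>S\<close> inside \<open>K\<close>.\<close>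
  have delta: "(\<Sum>i\<in>A. (if i = k then r else 0) *\<^sub>R f i) = r *\<^sub>R f k"
      if "finite A" "k \<in> A" for A k r and f :: "'k \<Rightarrow> 'y::real_vector"
    using that by (simp add: if_distrib[of "\<lambda>r. r *\<^sub>R _"] sum.delta cong: if_cong)
  have delta': "(\<Sum>i\<in>A. (if i = k then r else 0) * f i) = r * f k"
      if "finite A" "k \<in> A" for A k r and f :: "'k \<Rightarrow> real"
    using that by (simp add: if_distrib[of "\<lambda>r. r * _"] sum.delta cong: if_cong)
  have "(r *\<^sub>R a i, r * b i) \<in> K" if "i \<in> I" for i r
  proof -
    have "(r *\<^sub>R a i, r * b i) = comb (\<lambda>k. if k = i then r else 0) (\<lambda>_. 0) 0"
      using fin that by (simp add: comb_def delta delta')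
    then show ?thesis by (simp add: KI)
  qed
  from this[of _ 1] this[of _ "-1"]
  have "(a i, b i) \<in> K" "(- a i, - b i) \<in> K" if "i \<in> I" for i
    using that by simp_all
  moreover have "(c j, d j) \<in> K" if "j \<in> J" for j
  proof -
    have "(c j, d j) = comb (\<lambda>_. 0) (\<lambda>k. if k = j then 1 else 0) 0"
      using fin that by (simp add: comb_def delta delta')
    then show ?thesis by (simp add: KI)
  qed
  moreover have "(0, 1) = comb (\<lambda>_. 0) (\<lambda>_. 0) 1"
    by (simp add: comb_def)
  then have "(0, 1) \<in> K"
    by (simp add: KI)
  ultimately have "S \<subseteq> K"
    unfolding S_def by auto
  then have hull: "convex_cone hull S \<subseteq> K"
    using K by (simp add: hull_minimal)
  have "(0, -1) \<in> convex_cone hull S"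
  proof (rule ccontr)
    assume notin: "(0, -1) \<notin> convex_cone hull S"
    have "finite S"
      using fin by (simp add: S_def)
    then obtain p \<beta> where p: "p \<bullet> (0, -1) < \<beta>" "\<forall>x\<in>convex_cone hull S. p \<bullet> x > \<beta>"
      using separating_hyperplane_closed_point[OF convex_convex_cone_hull closed_convex_cone_hull notin]
      by blast
    have "\<beta> < 0"
      using p(2) convex_cone_hull_contains_0 by force
    \<comment> \<open>A generator with negative value could be scaled by the positive factor
      \<open>\<beta> / (p \<bullet> x)\<close>; its value would then be exactly
      \<open>\<beta>\<close>, against strict separation.\<close>
    have nonneg: "p \<bullet> x \<ge> 0" if "x \<in> S" for x
    proof (rule ccontr)
      assume neg: "\<not> p \<bullet> x \<ge> 0"
      then have "(\<beta> / (p \<bullet> x)) *\<^sub>R x \<in> convex_cone hull S"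
        using \<open>\<beta> < 0\<close> that by (intro convex_cone_hull_mul hull_inc) (auto simp: divide_nonpos_neg)
      then have "p \<bullet> ((\<beta> / (p \<bullet> x)) *\<^sub>R x) > \<beta>"
        using p(2) by blast
      then show False
        using neg by simp
    qed
    obtain v \<tau> where v: "p = (v, \<tau>)"
      by (cases p)
    \<comment> \<open>At \<open>(0, -1)\<close> the normal takes the value \<open>- \<tau>\<close>,
      which lies below \<open>\<beta> < 0\<close>.\<close>
    have pos: "\<tau> > 0"
      using p(1) \<open>\<beta> < 0\<close> by (simp add: v)
    have ge: "x \<bullet> v + r * \<tau> \<ge> 0" if "(x, r) \<in> S" for x r
      using nonneg[OF that] by (simp add: v inner_commute mult.commute)
    \<comment> \<open>Division by \<open>- \<tau>\<close> turns the homogeneous inequality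
      \<open>x \<bullet> v + r * \<tau> \<ge> 0\<close> into
      \<open>x \<bullet> y \<le> r\<close>.\<close>
    define y where "y = (- 1 / \<tau>) *\<^sub>R v"
    have le: "x \<bullet> y \<le> r" if "(x, r) \<in> S" for x r
      using ge[OF that] pos by (simp add: y_def field_simps)
    have "a i \<bullet> y = b i" if "i \<in> I" for i
      using le[of "a i" "b i"] le[of "- a i" "- b i"] that by (force simp: S_def)
    moreover have "c j \<bullet> y \<le> d j" if "j \<in> J" for j
      using le[of "c j" "d j"] that by (force simp: S_def)
    ultimately show False
      using infeasible by blast
  qed
  with hull obtain q1 q2 t where "\<forall>j\<in>J. 0 \<le> q2 j" "0 \<le> t" "(0, -1) = comb q1 q2 t"
    unfolding K_def by blast
  then show thesis
    by (intro that[of q2 q1]) (auto simp: comb_def)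
qed

section \<open>Flows and angles\<close>

lemma flow_component:
  "((Gamma G ** transpose (incidence G)) *v \<theta>) $ e
     = suscept G $ e * (column e (incidence G) \<bullet> \<theta>)"
  by (simp add: matrix_vector_mult_def matrix_matrix_mult_def Gamma_def diagmat_def transpose_def
      column_def inner_vec_def if_distrib[of "\<lambda>x. x * _"] sum_distrib_left mult.assoc cong: if_cong)

lemma column_incidence_inner:
  assumes "valid_grid G"
  shows "column e (incidence G) \<bullet> \<theta> = \<theta> $ src G e - \<theta> $ dst G e"
proof -
  have "src G e \<noteq> dst G e"
    using assms by (simp add: valid_grid_def)
  then have "column e (incidence G) = axis (src G e) 1 - axis (dst G e) 1"
    by (auto simp: vec_eq_iff column_def incidence_def axis_def)
  then show ?thesis
    by (simp add: inner_diff_left inner_axis')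
qed

text \<open>Summation by parts: transposition moves the incidence matrix from the flow to the
  potential.\<close>

lemma incidence_inner:
  "\<phi> \<bullet> (incidence G *v f) = (\<Sum>e\<in>UNIV. f $ e * (column e (incidence G) \<bullet> \<phi>))"
proof -
  have "\<phi> \<bullet> (incidence G *v f) = (\<Sum>u\<in>UNIV. \<Sum>e\<in>UNIV. f $ e * (incidence G $ u $ e * \<phi> $ u))"
    by (simp add: inner_vec_def matrix_vector_mult_def sum_distrib_left mult.commute mult.left_commute)
  also have "\<dots> = (\<Sum>e\<in>UNIV. f $ e * (column e (incidence G) \<bullet> \<phi>))"
    by (subst sum.swap) (simp add: inner_vec_def column_def sum_distrib_left)
  finally show ?thesis .
qed

lemma flow_law_comp:
  assumes "binary a" "flow_law G a \<theta> f"
  shows "f $ e = (1 - a $ e) * (suscept G $ e * (column e (incidence G) \<bullet> \<theta>))"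
  using assms unfolding binary_def flow_law_def
  by (metis diff_self diff_zero empty_iff insert_iff mult_1 mult_zero_left)

text \<open>Testing the balance of \<open>f - f'\<close> against \<open>\<theta> - \<theta>'\<close> shows that the two angle vectors differ by a
  vector \<open>\<delta>\<close> that is constant along the remaining lines. The square of \<open>\<delta>\<close> is constant along them
  as well, so testing the connectivity flow against it gives \<open>(\<Sum>u. \<delta>\<^sub>u\<^sup>2) = CARD('v) \<delta>\<^sub>r\<^sup>2 = 0\<close> where
  \<open>r\<close> is the reference bus.\<close>

lemma post_attack_angles_unique:
  fixes G :: "('v::finite, 'e::finite) grid"
  assumes valid: "valid_grid G" and bin: "binary a" and conn: "connectivity_flow G a g"
    and "post_attack_angles G a \<theta>" "post_attack_angles G a \<theta>'"
  shows "\<theta> = \<theta>'"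
proof -
  obtain f where f: "incidence G *v f = p0 G" "flow_law G a \<theta> f" "\<theta> $ ref_bus G = 0"
    using assms by (auto simp: post_attack_angles_def)
  obtain f' where f': "incidence G *v f' = p0 G" "flow_law G a \<theta>' f'" "\<theta>' $ ref_bus G = 0"
    using assms by (auto simp: post_attack_angles_def)
  define \<delta> where "\<delta> = \<theta> - \<theta>'"
  let ?d = "\<lambda>e. column e (incidence G) \<bullet> \<delta>"
  have pos: "suscept G $ e > 0" for e
    using valid by (simp add: suscept_def valid_grid_def)
  have a01: "a $ e = 0 \<or> a $ e = 1" for e
    using bin by (auto simp: binary_def)
  have "(f - f') $ e = (1 - a $ e) * suscept G $ e * ?d e" for e
    using flow_law_comp[OF bin f(2), of e] flow_law_comp[OF bin f'(2), of e]
    by (simp add: \<delta>_def inner_diff_right algebra_simps)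
  then have "\<delta> \<bullet> (incidence G *v (f - f'))
      = (\<Sum>e\<in>UNIV. (1 - a $ e) * suscept G $ e * (?d e)\<^sup>2)"
    by (simp only: incidence_inner power2_eq_square mult.assoc)
  moreover have "incidence G *v (f - f') = 0"
    using f f' by (simp add: matrix_vector_mult_diff_distrib)
  ultimately have "(\<Sum>e\<in>UNIV. (1 - a $ e) * suscept G $ e * (?d e)\<^sup>2) = 0"
    by simp
  moreover have "(1 - a $ e) * suscept G $ e * (?d e)\<^sup>2 \<ge> 0" for e
    using a01[of e] pos[of e] by auto
  ultimately have "(1 - a $ e) * suscept G $ e * (?d e)\<^sup>2 = 0" for e
    by (simp add: sum_nonneg_eq_0_iff)
  then have flat: "a $ e = 1 \<or> \<delta> $ src G e = \<delta> $ dst G e" for e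
    using less_imp_neq[OF pos[of e]] by (auto simp: column_incidence_inner[OF valid])
  \<comment> \<open>The capacity bound of the connectivity flow is zero on a disconnected
    line.\<close>
  have g0: "g $ e = 0" if "a $ e = 1" for e
    using conn that unfolding connectivity_flow_def
    by (metis abs_le_zero_iff diff_self mult_zero_right)
  define \<phi> :: "real^'v" where "\<phi> = (\<chi> u. (\<delta> $ u)\<^sup>2)"
  have "g $ e * (column e (incidence G) \<bullet> \<phi>) = 0" for e
    using flat[of e] g0[of e] by (auto simp: column_incidence_inner[OF valid] \<phi>_def)
  then have "\<phi> \<bullet> (incidence G *v g) = 0"
    unfolding incidence_inner by (intro sum.neutral ballI)
  moreover have "\<phi> $ u * (incidence G *v g) $ u = - ((\<delta> $ u)\<^sup>2)" for u
    using conn f(3) f'(3)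
    by (cases "u = ref_bus G") (auto simp: connectivity_flow_def \<phi>_def \<delta>_def)
  ultimately have "(\<Sum>u\<in>UNIV. (\<delta> $ u)\<^sup>2) = 0"
    by (simp add: inner_vec_def sum_negf)
  then show ?thesis
    by (simp add: sum_nonneg_eq_0_iff \<delta>_def vec_eq_iff)
qed

lemma theta2_eq:
  assumes "valid_grid G" "binary a" "connectivity_flow G a g" "post_attack_angles G a \<theta>"
  shows "theta2 G a = \<theta>"
  unfolding theta2_def
  using assms post_attack_angles_unique by (intro the_equality) blast+

lemma incidence_att_column:
  "column e (incidence_att G a) = (1 - a $ e) *\<^sub>R column e (incidence G)"
  by (simp add: vec_eq_iff column_def incidence_att_def matrix_matrix_mult_def diagmat_def
      if_distrib[of "\<lambda>x. _ * x"] algebra_simps cong: if_cong)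

lemma diagmat_mult_component: "(diagmat a *v x) $ i = a $ i * x $ i"
  by (simp add: matrix_vector_mult_def diagmat_def if_distrib[of "\<lambda>x. x * _"] cong: if_cong)

text \<open>Diagonal matrices commute, so the term subtracted in \<open>Bmat_att\<close> is the
  balance of the flows that the disconnected lines would carry. This links the flow variables of the
  attacker to the rows of the linear system.\<close>

lemma Bmat_att_flow:
  assumes "\<And>e. f $ e = (1 - a $ e) * (suscept G $ e * (column e (incidence G) \<bullet> \<theta>))"
  shows "incidence G *v f = Bmat_att G a *v \<theta>"
proof -
  let ?T = "transpose (incidence G)"
  have "(Gamma G ** diagmat a ** ?T) *v \<theta>
      = (\<chi> e. a $ e * (suscept G $ e * (column e (incidence G) \<bullet> \<theta>)))"
  proof -
    have "Gamma G ** diagmat a = diagmat a ** Gamma G"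
      by (simp add: vec_eq_iff matrix_matrix_mult_def Gamma_def diagmat_def
          if_distrib[of "\<lambda>x. x * _"] cong: if_cong)
    then have "(Gamma G ** diagmat a ** ?T) *v \<theta> = diagmat a *v ((Gamma G ** ?T) *v \<theta>)"
      by (simp add: matrix_vector_mul_assoc matrix_mul_assoc)
    also have "\<dots> = (\<chi> e. a $ e * ((Gamma G ** ?T) *v \<theta>) $ e)"
      by (simp add: vec_eq_iff diagmat_mult_component)
    finally show ?thesis
      by (simp add: flow_component)
  qed
  then have "f = (Gamma G ** ?T) *v \<theta> - (Gamma G ** diagmat a ** ?T) *v \<theta>"
    by (simp add: vec_eq_iff assms flow_component algebra_simps)
  then show ?thesis
    by (simp add: Bmat_att_def Bmat_def matrix_vector_mult_diff_distrib
        matrix_vector_mult_diff_rdistrib matrix_vector_mul_assoc matrix_mul_assoc)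
qed

section \<open>The attacker's problem\<close>

text \<open>The placement enters the attacker's constraints only through the premises
  \<open>xN = 1\<close> and \<open>xL = 1\<close>, and both indicators grow with the set of
  PMUs.\<close>

lemma attack_feasible_mono:
  assumes "attack_feasible G \<beta>' z" and le: "\<And>u. \<beta> $ u = 1 \<Longrightarrow> \<beta>' $ u = 1"
  shows "attack_feasible G \<beta> z"
proof -
  have "xN G \<beta>' $ u = 1" if "xN G \<beta> $ u = 1" for u
    using that le by (auto simp: xN_def split: if_splits)
  moreover have "xL G \<beta>' $ e = 1" if "xL G \<beta> $ e = 1" for e
    using that le by (auto simp: xL_def split: if_splits)
  ultimately show ?thesis
    using assms(1) unfolding attack_feasible_def not_blocked_def by blast
qed

lemma psi_a_eq_0_iff:
  fixes G :: "('v::finite, 'e::finite) grid"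
  shows "psi_a G \<beta> = 0 \<longleftrightarrow>
    (\<forall>z e. attack_feasible G \<beta> z \<longrightarrow> \<bar>fl3 z $ e\<bar> \<le> trip G e * f_max G $ e)"
proof -
  let ?n = "\<lambda>z::('v, 'e) attack_point. card {e. \<bar>fl3 z $ e\<bar> > trip G e * f_max G $ e}"
  have bdd: "bdd_above (?n ` {z. attack_feasible G \<beta> z})"
    by (rule bdd_aboveI[of _ "CARD('e)"]) (auto intro: card_mono)
  have "psi_a G \<beta> = 0 \<longleftrightarrow> (\<forall>z. attack_feasible G \<beta> z \<longrightarrow> ?n z = 0)"
  \<comment> \<open>Without feasible points both sides hold, by \<open>Sup {} = 0\<close> on
    \<open>nat\<close>. Otherwise the supremum rule for nonempty bounded families applies, with
    bound \<open>CARD('e)\<close>.\<close>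
  proof (cases "{z. attack_feasible G \<beta> z} = {}")
    case True
    then show ?thesis
      by (simp add: psi_a_def Sup_nat_def)
  next
    case False
    then have "psi_a G \<beta> \<le> 0 \<longleftrightarrow> (\<forall>z\<in>{z. attack_feasible G \<beta> z}. ?n z \<le> 0)"
      unfolding psi_a_def by (rule cSUP_le_iff[OF _ bdd])
    then show ?thesis by simp
  qed
  also have "\<dots> \<longleftrightarrow>
      (\<forall>z e. attack_feasible G \<beta> z \<longrightarrow> \<bar>fl3 z $ e\<bar> \<le> trip G e * f_max G $ e)"
    by (auto simp: not_less)
  finally show ?thesis .
qed

lemma psi_a_mono:
  assumes "psi_a G \<beta> = 0" and "\<And>u. \<beta> $ u = 1 \<Longrightarrow> \<beta>' $ u = 1"
  shows "psi_a G \<beta>' = 0"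
  using assms attack_feasible_mono unfolding psi_a_eq_0_iff by blast

lemma attack_feasible_admissible:
  assumes "attack_feasible G \<beta> z"
  shows "admissible_attack G (att z)"
  using assms unfolding attack_feasible_def admissible_attack_def post_attack_angles_def by blast

text \<open>A solution supplies the two falsified angle vectors and the final true one. The
  remaining components of an attack point come from \<open>a\<close> itself: the connectivity flow
  and the post-attack angles with their flow exist by admissibility, and the other flows are
  computed from the angles.\<close>

lemma solution_imp_overload:
  assumes valid: "valid_grid G" and adm: "admissible_attack G a" and nb: "not_blocked G \<beta> a"
    and \<sigma>: "\<sigma> \<in> {1, -1}" and sol: "solves_system G M \<beta> a e \<sigma> y"
    and strict: "F2 G a e \<sigma> Overload \<bullet> y < s2 G M a e Overload"
  shows "\<exists>z. attack_feasible G \<beta> z \<and> \<bar>fl3 z $ e\<bar> > trip G e * f_max G $ e"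
proof -
  obtain t2 t3 h3 where y: "y = (t2, t3, h3)"
    by (cases y)
  have bin: "binary a"
    using adm by (simp add: admissible_attack_def)
  obtain g \<theta> where g: "connectivity_flow G a g" and "post_attack_angles G a \<theta>"
    using adm by (auto simp: admissible_attack_def)
  then have "post_attack_angles G a (theta2 G a)"
    using theta2_eq[OF valid bin] by metis
  then obtain f where \<theta>: "theta2 G a $ ref_bus G = 0" and f: "incidence G *v f = p0 G"
      "flow_law G a (theta2 G a) f"
    by (auto simp: post_attack_angles_def)
  define f3 where "f3 = (\<chi> e. (1 - a $ e) * (suscept G $ e * (column e (incidence G) \<bullet> h3)))"
  define z where "z = \<lparr>att = a, th2 = theta2 G a, th3 = h3, tht2 = t2, tht3 = t3, fl2 = f, fl3 = f3,
    flt2 = (Gamma G ** transpose (incidence G)) *v t2, fcon = g\<rparr>"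
  have f3: "incidence G *v f3 = Bmat_att G a *v h3"
    by (rule Bmat_att_flow) (simp add: f3_def)
  have ft2: "incidence G *v ((Gamma G ** transpose (incidence G)) *v t2) = Bmat G *v t2"
    by (simp add: Bmat_def matrix_vector_mul_assoc matrix_mul_assoc)
  have eq: "F1 G a i \<bullet> y = s1 G i" if "i \<in> eq_rows G" for i
    using sol that by (simp add: solves_system_def)
  have ineq: "F2 G a e \<sigma> i \<bullet> y \<le> s2 G M a e i + F3 M i \<bullet> xN G \<beta>" if "i \<in> ineq_rows G" for i
    using sol that by (simp add: solves_system_def)
  note rows = y matrix_vector_mul_component inner_diff_left algebra_simps
  have gen2: "(Bmat G *v t2) $ u = p0 G $ u" if "u \<in> gen_buses G" for u
    using eq[of "GenFalse2 u"] that by (simp add: eq_rows_def rows)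
  have load3: "(Bmat_att G a *v h3) $ u = p0 G $ u" if "u \<in> load_buses G" for u
    using eq[of "LoadTrue3 u"] that by (simp add: eq_rows_def rows)
  have gen3: "(Bmat_att G a *v h3) $ u = (Bmat G *v t3) $ u" if "u \<in> gen_buses G" for u
    using eq[of "GenTrue3 u"] that by (simp add: eq_rows_def rows)
  have load: "(Bmat G *v t3) $ u = (Bmat G *v t2) $ u" if "u \<in> load_buses G" for u
    using eq[of "LoadFalse u"] that by (simp add: eq_rows_def rows)
  have ref: "t2 $ ref_bus G = 0" "t3 $ ref_bus G = 0" "h3 $ ref_bus G = 0"
    using eq[of RefFalse2] eq[of RefFalse3] eq[of RefTrue3]
    by (simp_all add: eq_rows_def y inner_axis')
  have fluct: "- (fluct G * \<bar>p0 G $ u\<bar>) \<le> (Bmat G *v t2) $ u - p0 G $ u"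
    "(Bmat G *v t2) $ u - p0 G $ u \<le> fluct G * \<bar>p0 G $ u\<bar>" for u
    using ineq[of "FluctUp u"] ineq[of "FluctLo u"] by (simp_all add: ineq_rows_def rows)
  \<comment> \<open>Where \<open>xN\<close> is 1, the term from \<open>F3\<close> cancels
    \<open>M\<close> in both rows, leaving two opposite bounds equal to the true angle.\<close>
  have pmu: "t2 $ u = theta2 G a $ u" if "xN G \<beta> $ u = 1" for u
    using ineq[of "PmuUp u"] ineq[of "PmuLo u"] that
    by (simp add: ineq_rows_def y inner_axis')
  have flow: "- f_max G \<le> (Gamma G ** transpose (incidence G)) *v t2"
    "(Gamma G ** transpose (incidence G)) *v t2 \<le> f_max G"
    "- f_max G \<le> (Gamma G ** transpose (incidence G)) *v t3"
    "(Gamma G ** transpose (incidence G)) *v t3 \<le> f_max G"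
    using ineq[of "Flow2Up _"] ineq[of "Flow2Lo _"] ineq[of "Flow3Up _"] ineq[of "Flow3Lo _"]
    by (auto simp: less_eq_vec_def flow_component ineq_rows_def y minus_le_iff)
  have gen: "pg_min G $ u \<le> (Bmat G *v t3) $ u" "(Bmat G *v t3) $ u \<le> pg_max G $ u"
    if "u \<in> gen_buses G" for u
    using ineq[of "GenLo u"] ineq[of "GenUp u"] that by (simp_all add: ineq_rows_def rows)
  have "attack_feasible G \<beta> z"
    unfolding attack_feasible_def z_def sced_region_def
    using bin g nb adm f \<theta> f3 ft2 gen2 load3 gen3 load ref fluct pmu flow gen
    by (auto simp: admissible_attack_def less_eq_vec_def abs_vec_def flow_law_def f3_def)
  \<comment> \<open>The factor \<open>1 - a $ e\<close> in the column of
    \<open>incidence_att\<close> is the one built into \<open>f3\<close>, so the overload row speaks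
    of the actual post-attack flow.\<close>
  moreover have "\<sigma> * f3 $ e > trip G e * f_max G $ e"
    using strict by (simp add: y f3_def incidence_att_column algebra_simps)
  then have "\<bar>f3 $ e\<bar> > trip G e * f_max G $ e"
    using \<sigma> by auto
  ultimately show ?thesis
    by (intro exI[of _ z]) (simp add: z_def)
qed

section \<open>The constraints of the master problem\<close>

lemma finite_eq_rows: "finite (eq_rows G)"
  by (simp add: eq_rows_def)

lemma finite_ineq_rows: "finite (ineq_rows G)"
  by (simp add: ineq_rows_def)

lemma sum_unit_ge_1_iff:
  assumes "finite A" "\<And>i. i \<in> A \<Longrightarrow> f i \<in> {0, 1::real}"
  shows "(\<Sum>i\<in>A. f i) \<ge> 1 \<longleftrightarrow> (\<exists>i\<in>A. f i = 1)"
proof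
  show "\<exists>i\<in>A. f i = 1" if "(\<Sum>i\<in>A. f i) \<ge> 1"
  proof (rule ccontr)
    assume "\<not> ?thesis"
    then have "(\<Sum>i\<in>A. f i) = 0"
      using assms(2) by (intro sum.neutral) blast
    with that show False by simp
  qed
  show "(\<Sum>i\<in>A. f i) \<ge> 1" if "\<exists>i\<in>A. f i = 1"
  proof -
    obtain i where "i \<in> A" "f i = 1"
      using \<open>\<exists>i\<in>A. f i = 1\<close> by blast
    then show ?thesis
      using assms member_le_sum[of i A f] by force
  qed
qed

lemma no_good_iff:
  assumes "binary \<beta>"
  shows "no_good c \<beta> \<longleftrightarrow> (\<exists>u. it_max c $ u = 0 \<and> \<beta> $ u = 1)"
  using sum_unit_ge_1_iff[of "{i. it_max c $ i = 0}" "\<lambda>i. \<beta> $ i"] assms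
  by (simp add: no_good_def binary_def)

lemma iteration_data_it_max:
  assumes "iteration_data G \<beta> c"
  shows "binary (it_max c)" "psi_a G (it_max c) \<noteq> 0" "\<beta> $ u = 1 \<Longrightarrow> it_max c $ u = 1"
  using assms by (auto simp: iteration_data_def is_arg_max_def extension_feasible_def)

text \<open>\<open>it_max\<close> extends the current placement, so none of that placement's PMUs
  sits at a zero of \<open>it_max\<close>.\<close>

lemma iteration_data_not_no_good:
  assumes "iteration_data G \<beta> c" "binary \<beta>"
  shows "\<not> no_good c \<beta>"
  using iteration_data_it_max(3)[OF assms(1)] assms(2)
  by (metis no_good_iff zero_neq_one)

text \<open>A violation would place all PMUs of \<open>\<beta>'\<close> inside
  \<open>it_max\<close>, and monotonicity would then exclude every overload under
  \<open>it_max\<close>.\<close>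

lemma ppop_feasible_no_good:
  assumes "iteration_data G \<beta> c" "ppop_feasible G \<beta>'"
  shows "no_good c \<beta>'"
proof (rule ccontr)
  assume "\<not> no_good c \<beta>'"
  then have "it_max c $ u = 1" if "\<beta>' $ u = 1" for u
    using that assms iteration_data_it_max(1)[OF assms(1)]
    by (auto simp: no_good_iff ppop_feasible_def binary_def)
  then show False
    using psi_a_mono[of G \<beta>' "it_max c"] iteration_data_it_max(2)[OF assms(1)] assms(2)
    by (auto simp: ppop_feasible_def)
qed

lemma ppop_feasible_attack_denial:
  assumes valid: "valid_grid G" and boundary: "boundary_disregarded G M"
    and data: "iteration_data G \<beta> c" and feas: "ppop_feasible G \<beta>'"
  shows "\<exists>q1 q2 w. attack_denial G M c \<beta>' q1 q2 w"
proof -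
  let ?a = "it_att c" and ?e = "it_line c" and ?\<sigma> = "it_dir c"
  obtain z where z: "attack_feasible G \<beta> z" "att z = ?a" and \<sigma>: "?\<sigma> \<in> {1, -1}"
    using data by (auto simp: iteration_data_def overload_direction_def)
  have adm: "admissible_attack G ?a"
    using attack_feasible_admissible[OF z(1)] z(2) by simp
  have bin: "binary ?a" "binary \<beta>'"
    using adm feas by (auto simp: admissible_attack_def ppop_feasible_def)
  have xL01: "xL G \<beta>' $ l \<in> {0, 1}" for l
    by (simp add: xL_def)
  show ?thesis
  proof (cases "not_blocked G \<beta>' ?a")
    case False
    then obtain l where "?a $ l = 1" "xL G \<beta>' $ l = 1"
      using bin(1) unfolding not_blocked_def binary_def by auto
    then have "(\<Sum>l | ?a $ l = 1. xL G \<beta>' $ l) \<ge> 1"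
      using xL01 by (subst sum_unit_ge_1_iff) auto
    \<comment> \<open>A monitored attacked line permits \<open>w = 1\<close>; the bound
      \<open>w - 1\<close> becomes 0 and zero multipliers suffice.\<close>
    then have "attack_denial G M c \<beta>' (\<lambda>_. 0) (\<lambda>_. 0) 1"
      by (simp add: attack_denial_def)
    then show ?thesis by blast
  next
    case True
    \<comment> \<open>Any solution could be replaced by one with strict overload, which yields a
      feasible attack contradicting \<open>psi_a G \<beta>' = 0\<close>.\<close>
    have "\<nexists>y. solves_system G M \<beta>' ?a ?e ?\<sigma> y"
    proof
      assume "\<exists>y. solves_system G M \<beta>' ?a ?e ?\<sigma> y"
      then obtain y where "solves_system G M \<beta>' ?a ?e ?\<sigma> y"
          "F2 G ?a ?e ?\<sigma> Overload \<bullet> y < s2 G M ?a ?e Overload"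
        using boundary True adm bin \<sigma> unfolding boundary_disregarded_def by blast
      from solution_imp_overload[OF valid adm True \<sigma> this] show False
        using feas unfolding ppop_feasible_def psi_a_eq_0_iff by (meson not_less)
    qed
    then have "\<nexists>y. (\<forall>i\<in>eq_rows G. F1 G ?a i \<bullet> y = s1 G i) \<and>
        (\<forall>i\<in>ineq_rows G. F2 G ?a ?e ?\<sigma> i \<bullet> y \<le> s2 G M ?a ?e i + F3 M i \<bullet> xN G \<beta>')"
      unfolding solves_system_def .
    then obtain q1 q2 where
      "\<And>i. i \<in> ineq_rows G \<Longrightarrow> q2 i \<ge> 0"
      "(\<Sum>i\<in>eq_rows G. q1 i *\<^sub>R F1 G ?a i) + (\<Sum>i\<in>ineq_rows G. q2 i *\<^sub>R F2 G ?a ?e ?\<sigma> i) = 0"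
      "(\<Sum>i\<in>eq_rows G. q1 i * s1 G i)
        + (\<Sum>i\<in>ineq_rows G. q2 i * (s2 G M ?a ?e i + F3 M i \<bullet> xN G \<beta>')) \<le> -1"
      by (rule farkas[OF finite_eq_rows finite_ineq_rows]) (rule that)
    \<comment> \<open>With \<open>w = 0\<close> the required bound is the -1 of Farkas' lemma, and
      the blocking sum only has to be nonnegative.\<close>
    then have "attack_denial G M c \<beta>' q1 q2 0"
      using xL01 by (auto simp: attack_denial_def xL_def intro: sum_nonneg)
    then show ?thesis by blast
  qed
qed

text \<open>The constraints of different iterations share only the placement, so the multipliers and
  \<open>w\<close> can be chosen for each iteration separately.\<close>

lemma ppop_feasible_master_feasible:
  assumes valid: "valid_grid G" and boundary: "boundary_disregarded G M"
    and data: "\<And>c. c \<in> set cs \<Longrightarrow> \<exists>\<beta>. iteration_data G \<beta> c" and feas: "ppop_feasible G \<beta>'"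
  shows "master_feasible G M cs \<beta>'"
proof -
  have "\<forall>k. \<exists>q1 q2 w. k < length cs \<longrightarrow>
      no_good (cs ! k) \<beta>' \<and> attack_denial G M (cs ! k) \<beta>' q1 q2 w"
    using data feas ppop_feasible_no_good ppop_feasible_attack_denial[OF valid boundary]
    by (metis nth_mem)
  then have "\<exists>q1 q2 w. \<forall>k<length cs.
      no_good (cs ! k) \<beta>' \<and> attack_denial G M (cs ! k) \<beta>' (q1 k) (q2 k) (w k)"
    by metis
  then show ?thesis
    using feas by (simp add: master_feasible_def ppop_feasible_def)
qed

section \<open>The algorithm\<close>

lemma ex_is_arg_min_nat:
  fixes f :: "'a \<Rightarrow> nat"
  assumes "P x"
  shows "\<exists>x. is_arg_min f P x"
  using ex_has_least_nat[of P x f] assms by (auto simp: is_arg_min_linorder)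

lemma norm0_le_card: "norm0 (x :: real^'n) \<le> CARD('n)"
  by (simp add: norm0_def card_mono)

lemma finite_binary: "finite {x :: real^'n. binary x}"
proof -
  have "{x :: real^'n. binary x} \<subseteq> (\<lambda>A. \<chi> i. if i \<in> A then 1 else 0) ` UNIV"
  proof
    fix x :: "real^'n"
    assume "x \<in> {x. binary x}"
    then have "x = (\<chi> i. if i \<in> {i. x $ i = 1} then 1 else 0)"
      by (auto simp: binary_def vec_eq_iff)
    then show "x \<in> (\<lambda>A. \<chi> i. if i \<in> A then 1 else 0) ` UNIV"
      by blast
  qed
  then show ?thesis
    by (rule finite_subset) simp
qed

lemma ex_iteration_data:
  assumes "psi_a G \<beta> \<noteq> 0" "binary \<beta>"
  shows "\<exists>c. iteration_data G \<beta> c"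
proof -
  obtain z e where z: "attack_feasible G \<beta> z" "\<bar>fl3 z $ e\<bar> > trip G e * f_max G $ e"
    using assms(1) unfolding psi_a_eq_0_iff by (auto simp: not_le)
  define \<sigma> :: real where "\<sigma> = (if fl3 z $ e \<ge> 0 then 1 else -1)"
  have "\<sigma> \<in> {1, -1}" "\<sigma> * fl3 z $ e = \<bar>fl3 z $ e\<bar>"
    by (simp_all add: \<sigma>_def)
  then have "overload_direction G \<beta> (att z) e \<sigma>"
    using z unfolding overload_direction_def by metis
  moreover have "successful_pair G \<beta> (att z) e"
    using z unfolding successful_pair_def by blast
  \<comment> \<open>The current placement extends itself, so there is a candidate, and
    \<open>norm0\<close> is bounded; hence a maximiser exists.\<close>
  moreover have "extension_feasible G \<beta> \<beta>"
    using assms by (simp add: extension_feasible_def)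
  then obtain \<beta>' where "is_arg_max norm0 (extension_feasible G \<beta>) \<beta>'"
    using ex_has_greatest_nat[of "extension_feasible G \<beta>" \<beta> norm0] norm0_le_card
    by (metis is_arg_max_linorder le_imp_less_Suc)
  ultimately have "iteration_data G \<beta> \<lparr>it_att = att z, it_line = e, it_dir = \<sigma>, it_max = \<beta>'\<rparr>"
    by (simp add: iteration_data_def)
  then show ?thesis ..
qed

lemma aodc_reaches_binary: "aodc_reaches G M cs \<beta> \<Longrightarrow> binary \<beta>"
  by (induction rule: aodc_reaches.induct)
    (auto simp: binary_def is_arg_min_def master_feasible_def)

lemma aodc_reaches_data:
  "aodc_reaches G M cs \<beta> \<Longrightarrow> c \<in> set cs \<Longrightarrow> \<exists>\<beta>. iteration_data G \<beta> c"
  by (induction rule: aodc_reaches.induct) auto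

text \<open>Before the first iteration only binarity is required, and the zero placement attains the
  smallest possible \<open>norm0\<close>. Later placements are minimisers by construction.\<close>

lemma aodc_reaches_is_arg_min:
  assumes "aodc_reaches G M cs \<beta>"
  shows "is_arg_min norm0 (master_feasible G M cs) \<beta>"
  using assms
proof cases
  case start
  then show ?thesis
    by (simp add: is_arg_min_def master_feasible_def binary_def norm0_def)
qed simp

text \<open>The number of excluded placements serves as a progress measure: every iteration excludes
  at least one more, namely its current placement.\<close>

lemma aodc_reaches_excluded:
  fixes G :: "('v::finite, 'e::finite) grid"
  assumes "aodc_reaches G M cs \<beta>"
  shows "length cs \<le> card {b. binary b \<and> (\<exists>c\<in>set cs. \<not> no_good c b)}"
  using assms
proof induction
  case start
  then show ?case by simp
next
  case (step cs \<beta> c \<beta>')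
  let ?E = "\<lambda>cs. {b :: real^'v. binary b \<and> (\<exists>c\<in>set cs. \<not> no_good c b)}"
  have fin: "finite (?E cs)" for cs
    by (rule finite_subset[OF _ finite_binary]) auto
  have bin: "binary \<beta>"
    using aodc_reaches_binary step.hyps(1) .
  have "\<not> no_good c \<beta>"
    using iteration_data_not_no_good step.hyps(3) bin .
  then have "insert \<beta> (?E cs) \<subseteq> ?E (cs @ [c])"
    using bin by auto
  then have "card (insert \<beta> (?E cs)) \<le> card (?E (cs @ [c]))"
    by (rule card_mono[OF fin])
  \<comment> \<open>The current placement solves the previous master problem, so it satisfies all
    earlier No-Good constraints and is newly excluded.\<close>
  moreover have "\<beta> \<notin> ?E cs"
    using aodc_reaches_is_arg_min[OF step.hyps(1)]
    by (auto simp: is_arg_min_def master_feasible_def in_set_conv_nth)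
  then have "card (insert \<beta> (?E cs)) = Suc (card (?E cs))"
    by (rule card_insert_disjoint[OF fin])
  ultimately show ?case
    using step.IH unfolding length_append by simp
qed

theorem mainTheorem4:
  fixes G :: "('v::finite, 'e::finite) grid" and M :: real
  assumes "valid_grid G"
    and "big_M G M"
    and "boundary_disregarded G M"
  shows
    \<comment> \<open>finitely many iterations, for all choices made\<close>
    "(\<exists>N. \<forall>cs \<beta>. aodc_reaches G M cs \<beta> \<longrightarrow> length cs \<le> N) \<and>
     \<comment> \<open>every iteration that does not stop can be carried out, for all choices made\<close>
     ((\<exists>\<beta>. ppop_feasible G \<beta>) \<longrightarrow>
       (\<forall>cs \<beta>. aodc_reaches G M cs \<beta> \<and> psi_a G \<beta> \<noteq> 0 \<longrightarrow>
          (\<exists>c. iteration_data G \<beta> c) \<and>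
          (\<forall>c. iteration_data G \<beta> c \<longrightarrow>
             (\<exists>\<beta>'. is_arg_min norm0 (master_feasible G M (cs @ [c])) \<beta>')))) \<and>
     \<comment> \<open>the returned placement is optimal\<close>
     (\<forall>\<beta>. aodc_returns G M \<beta> \<longrightarrow> is_arg_min norm0 (ppop_feasible G) \<beta>)"
proof (intro conjI impI allI; (elim conjE exE)?)
  have "length cs \<le> card {b :: real^'v. binary b}" if "aodc_reaches G M cs \<beta>" for cs \<beta>
    using aodc_reaches_excluded[OF that]
    by (rule order_trans) (auto intro: card_mono[OF finite_binary])
  then show "\<exists>N. \<forall>cs \<beta>. aodc_reaches G M cs \<beta> \<longrightarrow> length cs \<le> N"
    by blast
next
  fix cs \<beta>
  assume "aodc_reaches G M cs \<beta>" "psi_a G \<beta> \<noteq> 0"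
  then show "\<exists>c. iteration_data G \<beta> c"
    using ex_iteration_data aodc_reaches_binary by blast
next
  fix cs \<beta> c \<beta>0
  assume feas: "ppop_feasible G \<beta>0" and reach: "aodc_reaches G M cs \<beta>"
    and c: "iteration_data G \<beta> c"
  \<comment> \<open>A single PPOP-feasible placement keeps each master problem feasible; an
    objective with values in \<open>nat\<close> then attains its minimum.\<close>
  have "master_feasible G M (cs @ [c]) \<beta>0"
    using ppop_feasible_master_feasible[OF assms(1,3) _ feas, of "cs @ [c]"]
      aodc_reaches_data[OF reach] c by auto
  then show "\<exists>\<beta>'. is_arg_min norm0 (master_feasible G M (cs @ [c])) \<beta>'"
    by (rule ex_is_arg_min_nat)
next
  fix \<beta>
  assume "aodc_returns G M \<beta>"
  then obtain cs where reach: "aodc_reaches G M cs \<beta>" and "psi_a G \<beta> = 0"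
    by (auto simp: aodc_returns_def)
  then have "ppop_feasible G \<beta>"
    using aodc_reaches_binary by (auto simp: ppop_feasible_def)
  \<comment> \<open>Every PPOP-feasible placement competes in the master problem that
    \<open>\<beta>\<close> minimises.\<close>
  moreover have "norm0 \<beta> \<le> norm0 \<beta>'" if "ppop_feasible G \<beta>'" for \<beta>'
    using aodc_reaches_is_arg_min[OF reach] aodc_reaches_data[OF reach]
      ppop_feasible_master_feasible[OF assms(1,3) _ that, of cs]
    by (simp add: is_arg_min_linorder)
  ultimately show "is_arg_min norm0 (ppop_feasible G) \<beta>"
    by (simp add: is_arg_min_linorder)
qed

end
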